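(* Let $G(y)\in\mathbb{Z}[[y]]$ be a formal power series with integer coefficients and define the sequence $(b(n))_{n\ge0}$ by $$G(e^t-1)=\sum_{n\ge0}b(n)\frac{t^n}{n!}.$$ Then: (1) for every integer $k\ge2$, $\lambda(k)$ is an eventual period of $b(n)$ modulo $k$, i.e. $b(n+\lambda(k))\equiv b(n)\pmod k$ for all sufficiently large $n$, where $\lambda$ is the Carmichael function; (2) for every integer $i\ge0$, every prime $p$, and all integers $n,r\ge1$, $$b(np^r+i)\equiv b(np^{r-1}+i)\pmod{p^r}.$$
   Context: All identities are identities of formal power series in $t$ with rational coefficients; $G(e^t-1)$ denotes substitution of the series $e^t-1=\sum_{n\ge1}t^n/n!$ (which has zero constant term) into $G$. The numbers $b(n)$ are integers. The Carmichael function $\lambda(k)$ is the least positive integer $\ell$ such that $x^{\ell}\equiv1\pmod k$ for every integer $x$ coprime to $k$. *)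

theory Defs
  imports
    "HOL-Computational_Algebra.Computational_Algebra"
    "HOL-Number_Theory.Number_Theory"
begin

definition rat_fps :: "int fps \<Rightarrow> rat fps" where
  "rat_fps G = Abs_fps (\<lambda>n. of_int (fps_nth G n))"

text \<open>
  The exponential generating function identity \<open>G(e^t - 1) = (\<Sum>n. b(n) t^n / n!)\<close> in the ring
  of formal power series over the rationals. Library composition \<open>(oo)\<close> is the usual substitution
  here because \<open>fps_exp 1 - 1\<close> has zero constant term.
\<close>
definition is_exp_subst_coeffs :: "int fps \<Rightarrow> (nat \<Rightarrow> int) \<Rightarrow> bool" where
  "is_exp_subst_coeffs G b \<longleftrightarrow>
     rat_fps G oo (fps_exp 1 - 1) = Abs_fps (\<lambda>n. of_int (b n) / fact n)"

text \<open>
  For every \<open>G\<close> there is exactly one such sequence of integers, so taking \<open>b\<close> integer-valued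
  imposes no condition on \<open>G\<close>.
\<close>

lemma egf_integral_mult:
  fixes f g :: "rat fps"
  assumes f: "\<And>n. fact n * fps_nth f n \<in> \<int>" and g: "\<And>n. fact n * fps_nth g n \<in> \<int>"
  shows "fact n * fps_nth (f * g) n \<in> \<int>"
proof -
  have "fact n * fps_nth (f * g) n =
      (\<Sum>i=0..n. of_nat (n choose i) * ((fact i * fps_nth f i) * (fact (n - i) * fps_nth g (n - i))))"
    unfolding fps_mult_nth sum_distrib_left
    by (intro sum.cong refl) (simp add: binomial_fact field_simps)
  also have "\<dots> \<in> \<int>"
    by (intro Ints_sum Ints_mult Ints_of_nat f g)
  finally show ?thesis .
qed

lemma egf_integral_power:
  fixes f :: "rat fps"
  assumes "\<And>n. fact n * fps_nth f n \<in> \<int>"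
  shows "fact n * fps_nth (f ^ k) n \<in> \<int>"
proof (induction k arbitrary: n)
  case 0
  show ?case by simp
next
  case (Suc k)
  show ?case unfolding power_Suc by (rule egf_integral_mult) (use assms Suc in auto)
qed

lemma ex1_exp_subst_coeffs: "\<exists>!b. is_exp_subst_coeffs G b"
proof -
  let ?F = "rat_fps G oo (fps_exp 1 - 1)"
  have E: "fact n * fps_nth (fps_exp 1 - 1 :: rat fps) n \<in> \<int>" for n
    by (cases "n = 0") auto
  have "fact n * fps_nth ?F n \<in> \<int>" for n
  proof -
    have "fact n * fps_nth ?F n =
        (\<Sum>i=0..n. of_int (fps_nth G i) * (fact n * fps_nth ((fps_exp 1 - 1) ^ i) n))"
      by (simp add: fps_compose_nth rat_fps_def sum_distrib_left mult_ac)
    also have "\<dots> \<in> \<int>"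
      by (intro Ints_sum Ints_mult Ints_of_int egf_integral_power E)
    finally show ?thesis .
  qed
  hence "\<forall>n. \<exists>m. fact n * fps_nth ?F n = of_int m" by (auto elim: Ints_cases)
  then obtain b where b: "\<And>n. fact n * fps_nth ?F n = of_int (b n)" by metis
  show ?thesis
  proof (rule ex1I[of _ b])
    show "is_exp_subst_coeffs G b"
      by (simp add: is_exp_subst_coeffs_def fps_eq_iff flip: b)
  next
    fix c assume "is_exp_subst_coeffs G c"
    hence "fact n * fps_nth ?F n = of_int (c n)" for n
      by (simp add: is_exp_subst_coeffs_def)
    thus "c = b" using b by (auto simp: fun_eq_iff)
  qed
qed

text \<open>
  The library defines \<open>Carmichael k\<close> as the least common multiple of the orders of the units modulo
  \<open>k\<close>; this is the least common exponent of these units.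
\<close>
lemma Carmichael_eq_Least:
  assumes "k \<ge> 2"
  shows "Carmichael k =
    (LEAST l. 0 < l \<and> (\<forall>x::int. coprime x (int k) \<longrightarrow> [x ^ l = 1] (mod int k)))"
proof (rule sym, rule Least_equality)
  have "[x ^ Carmichael k = 1] (mod int k)" if x: "coprime x (int k)" for x :: int
  proof -
    define y where "y = nat (x mod int k)"
    have y: "int y = x mod int k" using assms by (simp add: y_def)
    have "coprime (int y) (int k)" unfolding y using x assms by simp
    hence "[y ^ Carmichael k = 1] (mod k)"
      by (intro Carmichael_divides) (auto simp: coprime_commute)
    hence "[int y ^ Carmichael k = 1] (mod int k)"
      by (metis cong_int_iff of_nat_1 of_nat_power)
    moreover have "[int y ^ Carmichael k = x ^ Carmichael k] (mod int k)"
      unfolding y by (intro cong_pow) (simp add: cong_def)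
    ultimately show ?thesis using cong_sym cong_trans by blast
  qed
  moreover have "Carmichael k > 0"
    using Carmichael_dvd_totient[of k] assms by (auto intro: Nat.gr0I)
  ultimately show "0 < Carmichael k \<and>
      (\<forall>x::int. coprime x (int k) \<longrightarrow> [x ^ Carmichael k = 1] (mod int k))" by blast
next
  fix l assume l: "0 < l \<and> (\<forall>x::int. coprime x (int k) \<longrightarrow> [x ^ l = 1] (mod int k))"
  have "ord k a dvd l" if "a \<in> totatives k" for a
  proof -
    have "coprime (int a) (int k)" using that by (simp add: totatives_def)
    hence "[int a ^ l = 1] (mod int k)" using l by blast
    hence "[a ^ l = 1] (mod k)" by (metis cong_int_iff of_nat_1 of_nat_power)
    thus ?thesis using ord_divides by blast
  qed
  hence "Carmichael k dvd l" unfolding Carmichael_def by (auto intro: Lcm_least)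
  thus "Carmichael k \<le> l" using l by (auto intro: dvd_imp_le)
qed

end

theory Submission
  imports Defs "HOL-Combinatorics.Stirling"
begin

text \<open>
  Modulo a fixed \<open>m\<close> the sequence \<open>b\<close> is an integer combination of finitely many power sequences
  \<open>n \<mapsto> j ^ n\<close>, so both claims reduce to congruences between powers of a single natural number.

  To see this, expand \<open>G(e\<^sup>t - 1)\<close> term by term. The coefficient of \<open>t\<^sup>n/n!\<close> in \<open>(e\<^sup>t - 1)\<^sup>k\<close> is
  \<open>k! S(n, k)\<close> with \<open>S\<close> the Stirling numbers of the second kind, whence
  \<open>b(n) = (\<Sum>k\<le>n. G\<^sub>k k! S(n, k))\<close>. As \<open>m\<close> divides \<open>k!\<close> for \<open>k \<ge> m\<close>, only the terms with \<open>k < m\<close>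
  survive modulo \<open>m\<close>, a range independent of \<open>n\<close>. Expanding \<open>(e\<^sup>t - 1)\<^sup>k\<close> by the binomial
  theorem instead writes \<open>k! S(n, k)\<close> as the alternating sum of \<open>(k choose j) j\<^sup>n\<close>,
  which gives the combination of power sequences (\<open>exp_subst_coeffs_cong_power_sum\<close>).

  Powers satisfy \<open>j ^ (s + d) \<equiv> j ^ s (mod m)\<close> whenever \<open>d\<close> is a multiple of \<open>\<lambda>(m)\<close> and \<open>s\<close> is at
  least every exponent in the factorization of \<open>m\<close> (\<open>power_add_Carmichael_cong\<close>): for each prime
  power exactly dividing \<open>m\<close>, either \<open>j\<close> is a unit modulo it, or both sides vanish.
  The first claim is the case \<open>d = \<lambda>(k)\<close>. The second is the case \<open>m = p\<^sup>r\<close> with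
  \<open>d = n p\<^sup>r - n p\<^sup>r\<^sup>-\<^sup>1 = n \<phi>(p\<^sup>r)\<close>, a multiple of \<open>\<lambda>(p\<^sup>r)\<close>, and \<open>s = n p\<^sup>r\<^sup>-\<^sup>1 + i \<ge> r\<close>.
\<close>

text \<open>
  Differentiating, \<open>D (e\<^sup>t - 1)\<^sup>k\<^sup>+\<^sup>1 = (k + 1) ((e\<^sup>t - 1)\<^sup>k\<^sup>+\<^sup>1 + (e\<^sup>t - 1)\<^sup>k)\<close>, which is the recurrence
  of the numbers \<open>k! S(n, k)\<close>.
\<close>
lemma fps_exp_minus_1_power_nth:
  "fact n * fps_nth ((fps_exp 1 - 1 :: 'a::field_char_0 fps) ^ k) n = of_nat (fact k * Stirling n k)"
proof (induction n arbitrary: k)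
  case 0
  show ?case by (cases k) (simp_all add: fps_power_zeroth)
next
  case (Suc n)
  let ?E = "fps_exp 1 - 1 :: 'a fps"
  show ?case
  proof (cases k)
    case 0
    then show ?thesis by simp
  next
    case [simp]: (Suc l)
    have deriv: "fps_deriv (?E ^ Suc l) = of_nat (Suc l) * (?E ^ Suc l + ?E ^ l)"
      unfolding fps_deriv_power' by (simp add: algebra_simps)
    have "fact (Suc n) * fps_nth (?E ^ Suc l) (Suc n) = fact n * fps_nth (fps_deriv (?E ^ Suc l)) n"
      by (simp only: fps_deriv_nth fact_Suc mult_ac flip: Suc_eq_plus1)
    also have "\<dots> = of_nat (Suc l) *
        (fact n * fps_nth (?E ^ Suc l) n + fact n * fps_nth (?E ^ l) n)"
      unfolding deriv by (simp add: fps_mult_of_nat_nth algebra_simps del: of_nat_Suc power_Suc)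
    also have "\<dots> = of_nat (fact (Suc l) * Stirling (Suc n) (Suc l))"
      unfolding Suc.IH by (simp add: algebra_simps)
    finally show ?thesis by simp
  qed
qed

text \<open>Comparing with the binomial expansion of \<open>(e\<^sup>t - 1)\<^sup>k\<close> into exponentials \<open>e\<^sup>j\<^sup>t\<close>.\<close>
lemma fact_mult_Stirling:
  "int (fact k * Stirling n k) = (\<Sum>j\<le>k. (-1) ^ (k - j) * int (k choose j) * int j ^ n)"
proof -
  have "(fps_exp 1 - 1 :: rat fps) ^ k = (\<Sum>j\<le>k. of_nat (k choose j) * fps_exp 1 ^ j * (-1) ^ (k - j))"
    using binomial_ring[of "fps_exp 1 :: rat fps" "-1" k] by simp
  also have "\<dots> = (\<Sum>j\<le>k. fps_const ((-1) ^ (k - j) * of_nat (k choose j)) * fps_exp (of_nat j))"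
  proof (intro sum.cong refl)
    fix j
    have "(-1 :: rat fps) ^ (k - j) = fps_const ((-1) ^ (k - j))"
      by (metis fps_const_1_eq_1 fps_const_neg fps_const_power)
    then show "of_nat (k choose j) * fps_exp 1 ^ j * (-1) ^ (k - j) =
        fps_const ((-1) ^ (k - j) * of_nat (k choose j)) * (fps_exp (of_nat j) :: rat fps)"
      by (simp add: fps_exp_power_mult fps_of_nat mult_ac flip: fps_const_mult del: fps_const_power)
  qed
  finally have "fact n * fps_nth ((fps_exp 1 - 1 :: rat fps) ^ k) n =
      (\<Sum>j\<le>k. (-1) ^ (k - j) * of_nat (k choose j) * of_nat j ^ n)"
    by (simp add: fps_sum_nth sum_distrib_left)
  then have "rat_of_int (int (fact k * Stirling n k)) =
      rat_of_int (\<Sum>j\<le>k. (-1) ^ (k - j) * int (k choose j) * int j ^ n)"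
    unfolding fps_exp_minus_1_power_nth by simp
  then show ?thesis by (simp only: of_int_eq_iff)
qed

lemma exp_subst_coeffs_eq_sum_Stirling:
  assumes "is_exp_subst_coeffs G b"
  shows "b n = (\<Sum>k\<le>n. fps_nth G k * int (fact k * Stirling n k))"
proof -
  have "rat_of_int (b n) = fact n * fps_nth (rat_fps G oo (fps_exp 1 - 1)) n"
    using assms by (simp add: is_exp_subst_coeffs_def)
  also have "\<dots> = (\<Sum>k\<le>n. of_int (fps_nth G k) * (fact n * fps_nth ((fps_exp 1 - 1) ^ k) n))"
    by (simp add: fps_compose_nth rat_fps_def sum_distrib_left mult_ac atLeast0AtMost)
  also have "\<dots> = rat_of_int (\<Sum>k\<le>n. fps_nth G k * int (fact k * Stirling n k))"
    unfolding fps_exp_minus_1_power_nth by simp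
  finally show ?thesis by (simp only: of_int_eq_iff)
qed

text \<open>
  The terms with \<open>k \<ge> m\<close> vanish modulo \<open>m\<close> because of the factor \<open>k!\<close>, and those with \<open>k > n\<close> vanish
  outright; so the sum over \<open>k \<le> n\<close> may be replaced by the sum over \<open>k < m\<close>.
\<close>
lemma exp_subst_coeffs_cong_power_sum:
  assumes "is_exp_subst_coeffs G b" and "m > 0"
  obtains c :: "nat \<Rightarrow> int" where "\<And>n. [b n = (\<Sum>j<m. c j * int j ^ n)] (mod int m)"
proof
  fix n
  let ?T = "\<lambda>k. fps_nth G k * int (fact k * Stirling n k)"
  let ?a = "\<lambda>k j. fps_nth G k * ((-1) ^ (k - j) * int (k choose j))"
  have "b n = (\<Sum>k<m + Suc n. ?T k)"
    unfolding exp_subst_coeffs_eq_sum_Stirling[OF assms(1)] by (rule sum.mono_neutral_left) auto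
  also have "\<dots> = (\<Sum>k<m. ?T k) + (\<Sum>k = m..<m + Suc n. ?T k)"
    using sum.atLeastLessThan_concat[of 0 m "m + Suc n" ?T] by (simp add: lessThan_atLeast0)
  also have "[\<dots> = (\<Sum>k<m. ?T k) + 0] (mod int m)"
  proof (intro cong_add cong_refl)
    have "int m dvd ?T k" if "k \<ge> m" for k
    proof -
      have "m dvd fact k * Stirling n k"
        using that \<open>m > 0\<close> by (intro dvd_mult2 dvd_fact) auto
      then show ?thesis by (intro dvd_mult) (simp only: int_dvd_int_iff)
    qed
    then show "[(\<Sum>k = m..<m + Suc n. ?T k) = 0] (mod int m)"
      unfolding cong_0_iff by (intro dvd_sum) auto
  qed
  also have "(\<Sum>k<m. ?T k) + 0 = (\<Sum>k<m. \<Sum>j<m. ?a k j * int j ^ n)"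
  proof -
    \<comment> \<open>Extending the inner range from \<open>j \<le> k\<close> to \<open>j < m\<close> adds only terms with \<open>k choose j = 0\<close>.\<close>
    have "?T k = (\<Sum>j<m. ?a k j * int j ^ n)" if "k < m" for k
    proof -
      have "?T k = (\<Sum>j\<le>k. ?a k j * int j ^ n)"
        unfolding fact_mult_Stirling sum_distrib_left by (simp add: mult_ac)
      also have "\<dots> = (\<Sum>j<m. ?a k j * int j ^ n)"
        using that by (intro sum.mono_neutral_left) auto
      finally show ?thesis .
    qed
    then show ?thesis by simp
  qed
  also have "\<dots> = (\<Sum>j<m. (\<Sum>k<m. ?a k j) * int j ^ n)"
    unfolding sum_distrib_right by (rule sum.swap)
  finally show "[b n = (\<Sum>j<m. (\<Sum>k<m. ?a k j) * int j ^ n)] (mod int m)" .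
qed

lemma exp_subst_coeffs_cong_if_powers_cong:
  assumes "is_exp_subst_coeffs G b" and "m > 0"
    and "\<And>j::nat. [j ^ s = j ^ t] (mod m)"
  shows "[b s = b t] (mod int m)"
proof -
  obtain c where c: "\<And>n. [b n = (\<Sum>j<m. c j * int j ^ n)] (mod int m)"
    using exp_subst_coeffs_cong_power_sum[OF assms(1,2)] by blast
  have "[int j ^ s = int j ^ t] (mod int m)" for j
    using assms(3)[of j] by (simp flip: cong_int_iff)
  then have "[(\<Sum>j<m. c j * int j ^ s) = (\<Sum>j<m. c j * int j ^ t)] (mod int m)"
    by (intro cong_sum cong_mult cong_refl)
  then show ?thesis
    using c[of s] c[of t] by (meson cong_sym cong_trans)
qed

text \<open>
  The bound on \<open>s\<close> makes \<open>j ^ s\<close> vanish modulo \<open>p ^ multiplicity p m\<close> for the primes \<open>p\<close> dividing \<open>j\<close>;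
  at the remaining primes \<open>j ^ d \<equiv> 1\<close>, as the Carmichael function of the \<open>p\<close>-part of \<open>m\<close>
  divides that of \<open>m\<close>.
\<close>
lemma power_add_Carmichael_cong:
  fixes j m s d :: nat
  assumes "m > 0" and mult: "\<And>p. prime p \<Longrightarrow> multiplicity p m \<le> s" and d: "Carmichael m dvd d"
  shows "[j ^ (s + d) = j ^ s] (mod m)"
proof -
  have local_cong: "[j ^ (s + d) = j ^ s] (mod p ^ multiplicity p m)" if p: "prime p" for p
  proof (cases "p dvd j")
    case True
    have "p ^ multiplicity p m dvd j ^ s"
      by (meson True dvd_power_le mult p dvd_trans le_imp_power_dvd dvd_power_same)
    then show ?thesis
      by (simp add: cong_def power_add mod_eq_0_iff_dvd)
  next
    case False
    obtain q where q: "m = p ^ multiplicity p m * q" "\<not> p dvd q"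
      using multiplicity_decompose'[of m p] \<open>m > 0\<close> p by (metis not_prime_unit less_irrefl)
    have "coprime (p ^ multiplicity p m) q"
      using p q(2) by (simp add: prime_imp_coprime)
    then have "Carmichael (p ^ multiplicity p m) dvd Carmichael m"
      by (metis Carmichael_mult_coprime dvd_lcm1 q(1))
    then have "[j ^ d = 1] (mod p ^ multiplicity p m)"
      using d False p by (intro Carmichael_divides) (auto intro: dvd_trans simp: prime_imp_coprime)
    then show ?thesis
      using cong_mult[OF cong_refl[of "j ^ s"]] by (fastforce simp: power_add)
  qed
  have "[j ^ (s + d) = j ^ s] (mod (\<Prod>p\<in>prime_factors m. p ^ multiplicity p m))"
    using local_cong by (intro coprime_cong_prod_nat) (auto simp: in_prime_factors_iff primes_coprime)
  then show ?thesis
    using \<open>m > 0\<close> by (simp add: prime_factorization_nat[symmetric])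
qed

theorem theorem2p6:
  fixes G :: "int fps" and b :: "nat \<Rightarrow> int"
  assumes "is_exp_subst_coeffs G b"
  shows "(\<forall>k::nat. k \<ge> 2 \<longrightarrow>
            (\<exists>N. \<forall>n\<ge>N. [b (n + Carmichael k) = b n] (mod int k))) \<and>
         (\<forall>(i::nat) (p::nat) (n::nat) (r::nat). prime p \<longrightarrow> n \<ge> 1 \<longrightarrow> r \<ge> 1 \<longrightarrow>
            [b (n * p ^ r + i) = b (n * p ^ (r - 1) + i)] (mod int p ^ r))"
proof (intro conjI allI impI)
  fix k :: nat assume "k \<ge> 2"
  then have "k > 0" by simp
  have "multiplicity p k \<le> k" if "prime p" for p
  proof -
    have "multiplicity p k < p ^ multiplicity p k"
      using prime_gt_1_nat[OF that] by (simp add: power_gt_expt)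
    also have "\<dots> \<le> k"
      using \<open>k > 0\<close> by (intro dvd_imp_le multiplicity_dvd)
    finally show ?thesis by simp
  qed
  then have "[b (n + Carmichael k) = b n] (mod int k)" if "n \<ge> k" for n
    using assms \<open>k > 0\<close> that
    by (intro exp_subst_coeffs_cong_if_powers_cong power_add_Carmichael_cong)
       (auto intro: order_trans)
  then show "\<exists>N. \<forall>n\<ge>N. [b (n + Carmichael k) = b n] (mod int k)" by blast
next
  fix i p n r :: nat assume p: "prime p" and "n \<ge> 1" "r \<ge> 1"
  let ?s = "n * p ^ (r - 1) + i"
  let ?d = "n * totient (p ^ r)"
  have "p > 1" using p by (rule prime_gt_1_nat)
  have "p ^ r = p ^ (r - 1) * (1 + (p - 1))"
    using \<open>r \<ge> 1\<close> \<open>p > 1\<close> by (cases r) auto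
  also have "\<dots> = p ^ (r - 1) + totient (p ^ r)"
    unfolding distrib_left using p \<open>r \<ge> 1\<close> by (simp add: totient_prime_power)
  finally have index: "n * p ^ r + i = ?s + ?d"
    by (metis add.assoc add.commute distrib_left)
  have "r \<le> ?s"
  proof -
    have "r - 1 < p ^ (r - 1)" using \<open>p > 1\<close> by (simp add: power_gt_expt)
    also have "\<dots> \<le> n * p ^ (r - 1)" using \<open>n \<ge> 1\<close> by simp
    finally show ?thesis by simp
  qed
  moreover have "multiplicity q (p ^ r) \<le> r" if "prime q" for q
    using p that by (cases "q = p") (auto simp: multiplicity_distinct_prime_power)
  ultimately have "[j ^ (?s + ?d) = j ^ ?s] (mod p ^ r)" for j
    using \<open>p > 1\<close> Carmichael_dvd_totient[of "p ^ r"]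
    by (intro power_add_Carmichael_cong) (auto intro: order_trans simp del: One_nat_def)
  then have "[b (n * p ^ r + i) = b ?s] (mod int (p ^ r))"
    unfolding index using assms \<open>p > 1\<close> by (intro exp_subst_coeffs_cong_if_powers_cong) auto
  then show "[b (n * p ^ r + i) = b ?s] (mod int p ^ r)" by simp
qed

end
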